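(* Let $d,n\ge 1$ be integers, let $A>0$, let $\sigma_1,\dots,\sigma_n>0$, and let $B=\{x\in\mathbb{R}^d:\|x\|^2\le dA\}$. Consider a Markov chain $$X_1\to Y_1\to X_2\to\cdots\to X_n\to Y_n\to X_{n+1}$$ in which $X_1$ takes values in $B$ almost surely and, for each $t\in\{1,\dots,n\}$, $P_{Y_t|X_t=x}=\mathcal{N}(x,\sigma_t^2\mathbf{I}_d)$ and $P_{X_{t+1}|Y_t}$ is an arbitrary Markov kernel from $\mathbb{R}^d$ to $B$ (so that $\|X_t\|^2\le dA$ a.s. for all $t\in\{1,\dots,n+1\}$). Let $\mu_1,\mu_1'$ be two probability measures on $B$, and let $\mu_{n+1}$ and $\mu'_{n+1}$ be the distributions of the output $X_{n+1}$ of this chain (with the same transition kernels) when $X_1\sim\mu_1$ and when $X_1\sim\mu_1'$, respectively. Then for every $\gamma>0$, $$\mathsf{E}_\gamma(\mu_{n+1}\|\mu'_{n+1})\le \mathsf{E}_\gamma(\mu_1\|\mu_1')\prod_{t=1}^n\theta_{\max\{\gamma,1/\gamma\}}\Big(\frac{2\sqrt{dA}}{\sigma_t}\Big).$$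
   Context: For $\gamma\ge 0$ and probability measures $\mu,\nu$ on the same space, the $\mathsf{E}_\gamma$-divergence is $\mathsf{E}_\gamma(\mu\|\nu)=\sup_{S}[\mu(S)-\gamma\nu(S)]-(1-\gamma)^+$, the supremum being over measurable sets $S$, with $(a)^+=\max(0,a)$. For $\gamma\ge1$ and $r>0$, $\theta_\gamma(r)=\mathsf{Q}\left(\frac{\log\gamma}{r}-\frac r2\right)-\gamma\,\mathsf{Q}\left(\frac{\log\gamma}{r}+\frac r2\right)$, where $\mathsf{Q}(a)=\frac{1}{\sqrt{2\pi}}\int_a^\infty e^{-u^2/2}\,du$. $\|\cdot\|$ is the Euclidean norm. *)

theory Defs
  imports "HOL-Probability.Probability"
begin

text \<open>For finite measures the values are bounded, so the supremum over the reals is the genuine one.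
  The definition is meant for measures with the same measurable sets.\<close>

definition E_div :: "real \<Rightarrow> 'a measure \<Rightarrow> 'a measure \<Rightarrow> real" where
  "E_div \<gamma> \<mu> \<nu> = (SUP S\<in>sets \<mu>. measure \<mu> S - \<gamma> * measure \<nu> S) - max 0 (1 - \<gamma>)"

definition Q_fun :: "real \<Rightarrow> real" where
  "Q_fun a = 1 / sqrt (2 * pi) * (LINT u:{a..}|lborel. exp (- u\<^sup>2 / 2))"

definition \<theta>_fun :: "real \<Rightarrow> real \<Rightarrow> real" where
  "\<theta>_fun \<gamma> r = Q_fun (ln \<gamma> / r - r / 2) - \<gamma> * Q_fun (ln \<gamma> / r + r / 2)"

text \<open>The isotropic normal law with mean \<open>x\<close> and covariance matrix \<open>\<sigma>\<^sup>2 I\<close>; the parameter \<open>\<sigma>\<close> is the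
  standard deviation, as in \<^const>\<open>normal_density\<close>.\<close>

definition gaussian :: "real \<Rightarrow> 'a::euclidean_space \<Rightarrow> 'a measure" where
  "gaussian \<sigma> x = density lborel (\<lambda>y. ennreal (\<Prod>b\<in>Basis. normal_density (x \<bullet> b) \<sigma> (y \<bullet> b)))"

text \<open>The \<open>\<sigma>\<close>-algebra on \<open>space M\<close> generated by a set \<open>\<Z>\<close> of random variables.\<close>

definition generated_algebra :: "'w measure \<Rightarrow> ('w \<Rightarrow> 'a::topological_space) set \<Rightarrow> 'w measure" where
  "generated_algebra M \<Z> = sigma (space M) {Z -` S \<inter> space M | Z S. Z \<in> \<Z> \<and> S \<in> sets borel}"

text \<open>Given \<open>F\<close>, the conditional law of \<open>Z\<close> is \<open>\<kappa> (W \<omega>)\<close>. If \<open>F\<close> is the \<open>\<sigma>\<close>-algebra of the past of a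
  process and \<open>W\<close> its most recent variable, this is the Markov property with transition kernel \<open>\<kappa>\<close>.\<close>

definition has_cond_law ::
  "'w measure \<Rightarrow> 'w measure \<Rightarrow> ('w \<Rightarrow> 'a::topological_space) \<Rightarrow> ('a \<Rightarrow> 'a measure) \<Rightarrow> ('w \<Rightarrow> 'a) \<Rightarrow> bool" where
  "has_cond_law M F Z \<kappa> W \<longleftrightarrow>
     (\<forall>S\<in>sets borel. AE \<omega> in M.
        real_cond_exp M F (indicator (Z -` S \<inter> space M)) \<omega> = measure (\<kappa> (W \<omega>)) S)"

text \<open>\<open>X 1 \<rightarrow> Y 1 \<rightarrow> X 2 \<rightarrow> \<dots> \<rightarrow> X n \<rightarrow> Y n \<rightarrow> X (n + 1)\<close> is a Markov chain in which \<open>Y t\<close> is obtained from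
  \<open>X t\<close> through the kernel \<open>G t\<close>, and \<open>X (t + 1)\<close> from \<open>Y t\<close> through the kernel \<open>K t\<close>. The initial law
  is unconstrained. Indices of \<open>X\<close> outside \<open>{1..n + 1}\<close> and of \<open>Y\<close> outside \<open>{1..n}\<close> are irrelevant.\<close>

definition markov_chain ::
  "nat \<Rightarrow> (nat \<Rightarrow> 'a \<Rightarrow> 'a measure) \<Rightarrow> (nat \<Rightarrow> 'a \<Rightarrow> 'a measure) \<Rightarrow>
    'w measure \<Rightarrow> (nat \<Rightarrow> 'w \<Rightarrow> 'a::topological_space) \<Rightarrow> (nat \<Rightarrow> 'w \<Rightarrow> 'a) \<Rightarrow> bool" where
  "markov_chain n G K M X Y \<longleftrightarrow>
     prob_space M \<and>
     (\<forall>t\<in>{1..n+1}. X t \<in> borel_measurable M) \<and>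
     (\<forall>t\<in>{1..n}. Y t \<in> borel_measurable M) \<and>
     (\<forall>t\<in>{1..n}.
        has_cond_law M (generated_algebra M (X ` {1..t} \<union> Y ` {1..<t})) (Y t) (G t) (X t) \<and>
        has_cond_law M (generated_algebra M (X ` {1..t} \<union> Y ` {1..t})) (X (t + 1)) (K t) (Y t))"

lemma subalgebra_generated_algebra:
  assumes "\<And>Z. Z \<in> \<Z> \<Longrightarrow> Z \<in> borel_measurable M"
  shows "subalgebra M (generated_algebra M \<Z>)"
proof -
  have "{Z -` S \<inter> space M | Z S. Z \<in> \<Z> \<and> S \<in> sets borel} \<subseteq> sets M"
    using assms by (auto intro: measurable_sets)
  moreover have "{Z -` S \<inter> space M | Z S. Z \<in> \<Z> \<and> S \<in> sets borel} \<subseteq> Pow (space M)"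
    by auto
  ultimately show ?thesis
    unfolding subalgebra_def generated_algebra_def
    by (simp add: sets.sigma_sets_subset)
qed

end

theory Submission
  imports Defs
begin

text \<open>
  For \<open>\<gamma> \<ge> 1\<close>, a Markov kernel whose outputs satisfy \<open>\<kappa> x S - \<gamma> \<kappa> y S \<le> \<theta>\<close> for all inputs \<open>x, y \<in> B\<close> contracts the
  \<open>E\<^sub>\<gamma>\<close>-divergence of laws on \<open>B\<close> by the factor \<open>\<theta>\<close>: with \<open>m = inf\<^sub>B \<kappa> x S\<close>, the function \<open>\<kappa> x S - m\<close> takes values in
  \<open>[0, \<theta> + (\<gamma> - 1) m]\<close>, and the contribution of \<open>m\<close> has a favourable sign since the divergence is at most 1.
  With \<open>\<theta> = 1\<close> this is data processing; for the Gaussian kernel, half-spaces are optimal (Neyman--Pearson), so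
  \<open>\<theta>\<close> is a one-dimensional normal computation. The case \<open>\<gamma> < 1\<close> reduces to \<open>1 / \<gamma>\<close> by exchanging the two laws.
\<close>

section \<open>Bounds on the divergence and exchange of its two arguments\<close>

text \<open>A supremum of reals dominates its members only if they are bounded above. Here 1 is a
  bound, because subtracting a nonnegative multiple of \<open>measure \<nu> S\<close> cannot raise a
  probability.\<close>

lemma E_div_upper:
  assumes "prob_space \<mu>" "0 \<le> \<gamma>" "S \<in> sets \<mu>"
  shows "measure \<mu> S - \<gamma> * measure \<nu> S \<le> E_div \<gamma> \<mu> \<nu> + max 0 (1 - \<gamma>)"
proof -
  interpret prob_space \<mu> by fact
  have "measure \<mu> T - \<gamma> * measure \<nu> T \<le> 1" for T
    using prob_le_1[of T] mult_nonneg_nonneg[OF \<open>0 \<le> \<gamma>\<close> measure_nonneg[of \<nu> T]] by linarith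
  then have "bdd_above ((\<lambda>T. measure \<mu> T - \<gamma> * measure \<nu> T) ` sets \<mu>)"
    by (auto intro!: bdd_aboveI)
  from cSUP_upper[OF \<open>S \<in> sets \<mu>\<close> this] show ?thesis
    by (simp add: E_div_def)
qed

lemma E_div_leI:
  assumes "\<And>S. S \<in> sets \<mu> \<Longrightarrow> measure \<mu> S - \<gamma> * measure \<nu> S \<le> c + max 0 (1 - \<gamma>)"
  shows "E_div \<gamma> \<mu> \<nu> \<le> c"
proof -
  have "(SUP S\<in>sets \<mu>. measure \<mu> S - \<gamma> * measure \<nu> S) \<le> c + max 0 (1 - \<gamma>)"
    using assms by (intro cSUP_least) auto
  then show ?thesis by (simp add: E_div_def)
qed

lemma E_div_nonneg:
  assumes "prob_space \<mu>" "1 \<le> \<gamma>"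
  shows "0 \<le> E_div \<gamma> \<mu> \<nu>"
  using E_div_upper[of \<mu> \<gamma> "{}" \<nu>] assms by simp

lemma E_div_le_1:
  assumes "prob_space \<mu>" "1 \<le> \<gamma>"
  shows "E_div \<gamma> \<mu> \<nu> \<le> 1"
proof (rule E_div_leI)
  interpret prob_space \<mu> by fact
  fix S
  have "0 \<le> \<gamma> * measure \<nu> S" using \<open>1 \<le> \<gamma>\<close> by simp
  then show "measure \<mu> S - \<gamma> * measure \<nu> S \<le> 1 + max 0 (1 - \<gamma>)"
    using prob_le_1[of S] max.cobounded1[of 0 "1 - \<gamma>"] by linarith
qed

text \<open>Pass to complements: a set \<open>S\<close> tested for \<open>\<mu>\<close> against
  \<open>\<nu>\<close> corresponds to \<open>space \<mu> - S\<close> tested for \<open>\<nu>\<close>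
  against \<open>\<mu>\<close>, after scaling by \<open>\<gamma>\<close> and shifting by
  \<open>1 - \<gamma>\<close>.\<close>

lemma E_div_swap_le:
  assumes "prob_space \<mu>" "prob_space \<nu>" "sets \<mu> = sets \<nu>" "0 < \<gamma>"
  shows "E_div \<gamma> \<mu> \<nu> \<le> \<gamma> * E_div (1 / \<gamma>) \<nu> \<mu>"
proof (rule E_div_leI)
  interpret \<mu>: prob_space \<mu> by fact
  interpret \<nu>: prob_space \<nu> by fact
  fix S assume S: "S \<in> sets \<mu>"
  let ?C = "space \<mu> - S"
  have "measure \<nu> ?C - 1 / \<gamma> * measure \<mu> ?C \<le> E_div (1 / \<gamma>) \<nu> \<mu> + max 0 (1 - 1 / \<gamma>)"
    using S assms by (intro E_div_upper) auto
  moreover have "measure \<mu> ?C = 1 - measure \<mu> S" "measure \<nu> ?C = 1 - measure \<nu> S"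
    using S assms \<mu>.prob_compl[of S] \<nu>.prob_compl[of S] sets_eq_imp_space_eq[of \<mu> \<nu>] by auto
  ultimately have "1 - measure \<nu> S - 1 / \<gamma> * (1 - measure \<mu> S)
      \<le> E_div (1 / \<gamma>) \<nu> \<mu> + max 0 (1 - 1 / \<gamma>)"
    by simp
  from mult_left_mono[OF this, of \<gamma>] have "\<gamma> - \<gamma> * measure \<nu> S - 1 + measure \<mu> S
      \<le> \<gamma> * E_div (1 / \<gamma>) \<nu> \<mu> + \<gamma> * max 0 (1 - 1 / \<gamma>)"
    using \<open>0 < \<gamma>\<close> by (simp add: algebra_simps)
  \<comment> \<open>The correction terms match because
    \<open>max 0 (\<gamma> - 1) + (1 - \<gamma>) = max 0 (1 - \<gamma>)\<close>.\<close>
  moreover have "\<gamma> * max 0 (1 - 1 / \<gamma>) = max 0 (\<gamma> - 1)"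
    using \<open>0 < \<gamma>\<close> by (auto simp: max_def field_simps)
  ultimately show "measure \<mu> S - \<gamma> * measure \<nu> S \<le> \<gamma> * E_div (1 / \<gamma>) \<nu> \<mu> + max 0 (1 - \<gamma>)"
    by linarith
qed

text \<open>The one-sided inequality is an equality because it can be applied again with the laws
  exchanged and \<open>1 / \<gamma>\<close> in place of \<open>\<gamma>\<close>.\<close>

lemma E_div_swap:
  assumes "prob_space \<mu>" "prob_space \<nu>" "sets \<mu> = sets \<nu>" "0 < \<gamma>"
  shows "E_div \<gamma> \<mu> \<nu> = \<gamma> * E_div (1 / \<gamma>) \<nu> \<mu>"
proof (rule antisym[OF E_div_swap_le[OF assms]])
  have "E_div (1 / \<gamma>) \<nu> \<mu> \<le> 1 / \<gamma> * E_div \<gamma> \<mu> \<nu>"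
    using E_div_swap_le[of \<nu> \<mu> "1 / \<gamma>"] assms by simp
  then show "\<gamma> * E_div (1 / \<gamma>) \<nu> \<mu> \<le> E_div \<gamma> \<mu> \<nu>"
    using \<open>0 < \<gamma>\<close> by (simp add: field_simps)
qed

section \<open>Integrals of bounded functions and contraction under kernels\<close>

text \<open>Counting the integer thresholds \<open>1..N\<close> that \<open>t\<close> reaches gives
  the floor of \<open>t\<close>. This is a finite layer-cake decomposition with error at most
  1.\<close>

lemma count_le_bounds:
  fixes t :: real
  assumes "0 \<le> t" "t \<le> real N"
  shows "(\<Sum>k=1..N. indicator {real k..} t) \<le> t" "t \<le> (\<Sum>k=1..N. indicator {real k..} t) + 1"
proof -
  have "(\<Sum>k=1..n. indicator {real k..} t) = real (min n (nat \<lfloor>t\<rfloor>))" for n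
  proof (induction n)
    case (Suc n)
    have "real (Suc n) \<le> t \<longleftrightarrow> Suc n \<le> nat \<lfloor>t\<rfloor>"
      using \<open>0 \<le> t\<close> by linarith
    then show ?case using Suc by (auto simp: indicator_def min_def)
  qed simp
  moreover have "nat \<lfloor>t\<rfloor> \<le> N" using assms by linarith
  ultimately have *: "(\<Sum>k=1..N. indicator {real k..} t) = real (nat \<lfloor>t\<rfloor>)" by simp
  show "(\<Sum>k=1..N. indicator {real k..} t) \<le> t" "t \<le> (\<Sum>k=1..N. indicator {real k..} t) + 1"
    unfolding * using \<open>0 \<le> t\<close> by linarith+
qed

text \<open>Extends the defining bound from sets to functions with values in \<open>[0, c]\<close>:
  \<open>g\<close> is approximated by a multiple of a sum of indicators of its superlevel sets, each
  of which is a test set for the divergence.\<close>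

lemma integral_diff_le_E_div:
  fixes g :: "'a \<Rightarrow> real"
  assumes "prob_space \<mu>" "prob_space \<nu>" and sets: "sets \<nu> = sets \<mu>" and \<gamma>: "1 \<le> \<gamma>"
    and g[measurable]: "g \<in> borel_measurable \<mu>"
    and bounds: "\<And>x. 0 \<le> g x" "\<And>x. g x \<le> c"
  shows "(\<integral>x. g x \<partial>\<mu>) - \<gamma> * (\<integral>x. g x \<partial>\<nu>) \<le> c * E_div \<gamma> \<mu> \<nu>"
proof (cases "c > 0")
  case False
  then have "g x = 0" "c = 0" for x
    using bounds[of x] by linarith+
  then show ?thesis by simp
next
  case c: True
  interpret \<mu>: prob_space \<mu> by fact
  interpret \<nu>: prob_space \<nu> by fact
  have g'[measurable]: "g \<in> borel_measurable \<nu>"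
    using g sets measurable_cong_sets by blast
  define a where "a = E_div \<gamma> \<mu> \<nu>"
  \<comment> \<open>Rescale \<open>g\<close> to \<open>h\<close> with values in
    \<open>[0, N]\<close> and round down to the integer-valued \<open>s\<close>. The rounding error
    of at most 1 becomes \<open>c / N\<close> after scaling back.\<close>
  have bound: "(\<integral>x. g x \<partial>\<mu>) - \<gamma> * (\<integral>x. g x \<partial>\<nu>) \<le> c * a + c / real (Suc n)" for n
  proof -
    define N where "N = Suc n"
    define h where "h x = real N * g x / c" for x
    define s where "s x = (\<Sum>k=1..N. indicator {real k..} (h x) :: real)" for x
    define T where "T k = h -` {real k..} \<inter> space \<mu>" for k
    have N: "0 < real N" by (simp add: N_def)
    have h[measurable]: "h \<in> borel_measurable \<mu>" "h \<in> borel_measurable \<nu>"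
      unfolding h_def by measurable
    have h_bounds: "0 \<le> h x" "h x \<le> real N" for x
      using bounds[of x] c N unfolding h_def by (auto simp: field_simps)
    have s: "s x \<le> h x" "h x \<le> s x + 1" for x
      using count_le_bounds[OF h_bounds] by (auto simp: s_def)
    have T[measurable]: "T k \<in> sets \<mu>" "T k \<in> sets \<nu>" for k
      unfolding T_def using h(1) sets by (auto intro: measurable_sets)
    have sp: "space \<nu> = space \<mu>" using sets by (rule sets_eq_imp_space_eq)
    have ind: "indicator {real k..} (h x) = (indicator (T k) x :: real)" if "x \<in> space \<mu>" for k x
      using that by (auto simp: T_def indicator_def)
    have int_s: "(\<integral>x. s x \<partial>\<mu>) = (\<Sum>k=1..N. measure \<mu> (T k))"
      "(\<integral>x. s x \<partial>\<nu>) = (\<Sum>k=1..N. measure \<nu> (T k))"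
      "integrable \<mu> s" "integrable \<nu> s"
    proof -
      have *: "(\<integral>x. s x \<partial>\<mu>) = (\<integral>x. (\<Sum>k=1..N. indicator (T k) x) \<partial>\<mu>)"
        unfolding s_def by (intro Bochner_Integration.integral_cong sum.cong ind) auto
      show "(\<integral>x. s x \<partial>\<mu>) = (\<Sum>k=1..N. measure \<mu> (T k))"
        unfolding * by (subst Bochner_Integration.integral_sum) (auto simp: \<mu>.emeasure_eq_measure)
      have *: "(\<integral>x. s x \<partial>\<nu>) = (\<integral>x. (\<Sum>k=1..N. indicator (T k) x) \<partial>\<nu>)"
        unfolding s_def by (intro Bochner_Integration.integral_cong sum.cong ind) (auto simp: sp)
      show "(\<integral>x. s x \<partial>\<nu>) = (\<Sum>k=1..N. measure \<nu> (T k))"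
        unfolding * by (subst Bochner_Integration.integral_sum) (auto simp: \<nu>.emeasure_eq_measure)
      have "\<bar>s x\<bar> \<le> real N" for x
      proof -
        have "0 \<le> s x" unfolding s_def by (intro sum_nonneg) auto
        then show ?thesis using s[of x] h_bounds[of x] by linarith
      qed
      then show "integrable \<mu> s" "integrable \<nu> s"
        unfolding s_def
        by (auto intro!: \<mu>.integrable_const_bound[where B="real N"] \<nu>.integrable_const_bound[where B="real N"])
    qed
    have int_h: "integrable \<mu> h" "integrable \<nu> h"
      using h_bounds by (auto intro!: \<mu>.integrable_const_bound[where B="real N"]
          \<nu>.integrable_const_bound[where B="real N"])
    \<comment> \<open>Since \<open>\<nu>\<close> enters with a negative sign, \<open>h\<close> is
      bounded above by \<open>s + 1\<close> under \<open>\<mu>\<close> but below by \<open>s\<close>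
      under \<open>\<nu>\<close>. The error is therefore paid only once, free of
      \<open>\<gamma>\<close>.\<close>
    have "(\<integral>x. h x \<partial>\<mu>) \<le> (\<integral>x. s x + 1 \<partial>\<mu>)"
      using s int_h int_s by (intro integral_mono) auto
    also have "\<dots> = (\<Sum>k=1..N. measure \<mu> (T k)) + 1"
      using int_s by (simp add: \<mu>.prob_space)
    finally have 1: "(\<integral>x. h x \<partial>\<mu>) \<le> (\<Sum>k=1..N. measure \<mu> (T k)) + 1" .
    have "(\<integral>x. s x \<partial>\<nu>) \<le> (\<integral>x. h x \<partial>\<nu>)"
      using s int_h int_s by (intro integral_mono) auto
    then have 2: "\<gamma> * (\<Sum>k=1..N. measure \<nu> (T k)) \<le> \<gamma> * (\<integral>x. h x \<partial>\<nu>)"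
      using int_s \<gamma> by (intro mult_left_mono) auto
    have "(\<Sum>k=1..N. measure \<mu> (T k)) - \<gamma> * (\<Sum>k=1..N. measure \<nu> (T k))
        = (\<Sum>k=1..N. measure \<mu> (T k) - \<gamma> * measure \<nu> (T k))"
      by (simp add: sum_subtractf sum_distrib_left)
    \<comment> \<open>For \<open>\<gamma> \<ge> 1\<close> the correction
      \<open>max 0 (1 - \<gamma>)\<close> vanishes, so each superlevel set contributes at most
      \<open>a\<close>.\<close>
    also have "\<dots> \<le> (\<Sum>k=1..N. a)"
      using E_div_upper[OF \<open>prob_space \<mu>\<close> _ T(1), where \<gamma>=\<gamma> and \<nu>=\<nu>] \<gamma>
      by (intro sum_mono) (simp add: a_def)
    finally have "(\<integral>x. h x \<partial>\<mu>) - \<gamma> * (\<integral>x. h x \<partial>\<nu>) \<le> real N * a + 1"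
      using 1 2 by simp
    moreover have "(\<integral>x. h x \<partial>\<mu>) = real N / c * (\<integral>x. g x \<partial>\<mu>)"
      "(\<integral>x. h x \<partial>\<nu>) = real N / c * (\<integral>x. g x \<partial>\<nu>)"
      unfolding h_def by simp_all
    ultimately have "real N / c * ((\<integral>x. g x \<partial>\<mu>) - \<gamma> * (\<integral>x. g x \<partial>\<nu>)) \<le> real N * a + 1"
      by (simp add: algebra_simps)
    then show ?thesis
      using N c unfolding N_def[symmetric] by (simp add: field_simps)
  qed
  have "(\<lambda>n. c * a + c / real (Suc n)) \<longlonglongrightarrow> c * a + 0"
    by (intro tendsto_add tendsto_const LIMSEQ_Suc lim_const_over_n)
  then have "(\<integral>x. g x \<partial>\<mu>) - \<gamma> * (\<integral>x. g x \<partial>\<nu>) \<le> c * a + 0"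
    by (rule LIMSEQ_le_const) (use bound in auto)
  then show ?thesis by (simp add: a_def)
qed

lemma E_div_bind_le:
  assumes \<mu>: "\<mu> \<in> space (prob_algebra M)" and \<nu>: "\<nu> \<in> space (prob_algebra M)"
    and \<kappa>[measurable]: "\<kappa> \<in> M \<rightarrow>\<^sub>M prob_algebra N" and \<gamma>: "1 \<le> \<gamma>"
    and B: "B \<in> sets M" "measure \<mu> B = 1" "measure \<nu> B = 1"
    and le: "\<And>x y S. x \<in> B \<Longrightarrow> y \<in> B \<Longrightarrow> S \<in> sets N \<Longrightarrow>
      measure (\<kappa> x) S - \<gamma> * measure (\<kappa> y) S \<le> \<theta>"
  shows "E_div \<gamma> (\<mu> \<bind> \<kappa>) (\<nu> \<bind> \<kappa>) \<le> \<theta> * E_div \<gamma> \<mu> \<nu>"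
proof (rule E_div_leI)
  have p: "prob_space \<mu>" "prob_space \<nu>" and sets_eq[simp, measurable_cong]: "sets \<mu> = sets M" "sets \<nu> = sets M"
    using \<mu> \<nu> by (auto simp: space_prob_algebra)
  interpret \<mu>: prob_space \<mu> by fact
  interpret \<nu>: prob_space \<nu> by fact
  have \<kappa>_sub: "\<kappa> \<in> M \<rightarrow>\<^sub>M subprob_algebra N"
    using \<kappa> by (rule measurable_prob_algebraD)
  have sp: "space \<mu> = space M" by (rule sets_eq_imp_space_eq) simp
  have ne: "space \<mu> \<noteq> {}" by (rule \<mu>.not_empty)
  have sets_bind: "sets (\<mu> \<bind> \<kappa>) = sets N"
    using ne sp by (intro sets_bind subprob_measurableD(2)[OF \<kappa>_sub]) auto
  fix S assume "S \<in> sets (\<mu> \<bind> \<kappa>)"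
  then have S[measurable]: "S \<in> sets N" by (simp add: sets_bind)
  define a where "a = E_div \<gamma> \<mu> \<nu>"
  have a: "0 \<le> a" "a \<le> 1"
    using E_div_nonneg E_div_le_1 p \<gamma> by (auto simp: a_def)
  define f where "f x = measure (\<kappa> x) S" for x
  define m where "m = (INF x\<in>B. f x)"
  \<comment> \<open>Setting \<open>g\<close> to 0 off \<open>B\<close> makes its bounds hold at
    every point, as \<open>integral_diff_le_E_div\<close> demands, and changes no integral because
    both laws are concentrated on \<open>B\<close>.\<close>
  define g where "g x = (if x \<in> B then f x - m else 0)" for x
  have f[measurable]: "f \<in> borel_measurable M" unfolding f_def by measurable
  have "B \<noteq> {}" using B by auto
  have f0: "0 \<le> f x" for x by (simp add: f_def)
  have m0: "0 \<le> m" unfolding m_def using \<open>B \<noteq> {}\<close> f0 by (intro cINF_greatest) auto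
  have m_le: "m \<le> f x" if "x \<in> B" for x
    unfolding m_def using f0 that by (intro cINF_lower) (auto intro!: bdd_belowI[where m=0])
  \<comment> \<open>The kernel hypothesis with \<open>x\<close> fixed bounds \<open>f y\<close>
    below uniformly in \<open>y\<close>, hence also bounds the infimum \<open>m\<close>.\<close>
  have le_m: "f x \<le> \<theta> + \<gamma> * m" if "x \<in> B" for x
  proof -
    have "(f x - \<theta>) / \<gamma> \<le> m" unfolding m_def
    proof (rule cINF_greatest)
      fix y assume "y \<in> B"
      from le[OF that this S] show "(f x - \<theta>) / \<gamma> \<le> f y"
        using \<gamma> by (simp add: f_def field_simps)
    qed fact
    then show ?thesis using \<gamma> by (simp add: field_simps)
  qed
  have g[measurable]: "g \<in> borel_measurable M" unfolding g_def using B by measurable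
  \<comment> \<open>Needed as the upper bound of \<open>g\<close> off \<open>B\<close>; it follows
    from \<open>m \<le> f x \<le> \<theta> + \<gamma> * m\<close> at any point of the nonempty
    \<open>B\<close>.\<close>
  have c: "0 \<le> \<theta> + (\<gamma> - 1) * m"
    using \<open>B \<noteq> {}\<close> le_m m_le by (force simp: algebra_simps)
  have g_bounds: "0 \<le> g x" "g x \<le> \<theta> + (\<gamma> - 1) * m" for x
    using m_le[of x] le_m[of x] c by (auto simp: g_def algebra_simps)
  have AE: "AE x in \<mu>. x \<in> B" "AE x in \<nu>. x \<in> B"
    using B \<mu>.prob_eq_1[of B] \<nu>.prob_eq_1[of B] by auto
  have int_f: "(\<integral>x. f x \<partial>\<mu>) = m + (\<integral>x. g x \<partial>\<mu>)" "(\<integral>x. f x \<partial>\<nu>) = m + (\<integral>x. g x \<partial>\<nu>)"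
  proof -
    have "integrable \<mu> g" "integrable \<nu> g"
      using g_bounds by (auto intro!: \<mu>.integrable_const_bound[where B="\<theta> + (\<gamma> - 1) * m"]
          \<nu>.integrable_const_bound[where B="\<theta> + (\<gamma> - 1) * m"])
    moreover have "AE x in \<mu>. f x = m + g x" "AE x in \<nu>. f x = m + g x"
      using AE by (auto elim!: eventually_mono simp: g_def)
    then have "(\<integral>x. f x \<partial>\<mu>) = (\<integral>x. m + g x \<partial>\<mu>)" "(\<integral>x. f x \<partial>\<nu>) = (\<integral>x. m + g x \<partial>\<nu>)"
      by (auto intro!: integral_cong_AE)
    ultimately show "(\<integral>x. f x \<partial>\<mu>) = m + (\<integral>x. g x \<partial>\<mu>)" "(\<integral>x. f x \<partial>\<nu>) = m + (\<integral>x. g x \<partial>\<nu>)"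
      by (simp_all add: \<mu>.prob_space \<nu>.prob_space)
  qed
  have "measure (\<mu> \<bind> \<kappa>) S - \<gamma> * measure (\<nu> \<bind> \<kappa>) S = (\<integral>x. f x \<partial>\<mu>) - \<gamma> * (\<integral>x. f x \<partial>\<nu>)"
    unfolding f_def using \<kappa>_sub S
    by (subst (1 2) subprob_space.measure_bind[where N=N])
       (auto intro: \<mu>.subprob_space_axioms \<nu>.subprob_space_axioms)
  also have "\<dots> = (1 - \<gamma>) * m + ((\<integral>x. g x \<partial>\<mu>) - \<gamma> * (\<integral>x. g x \<partial>\<nu>))"
    by (simp add: int_f algebra_simps)
  also have "\<dots> \<le> (1 - \<gamma>) * m + (\<theta> + (\<gamma> - 1) * m) * a"
    unfolding a_def using p \<gamma> g_bounds by (intro add_left_mono integral_diff_le_E_div) auto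
  \<comment> \<open>The two terms in \<open>m\<close> combine into one that is nonpositive because
    \<open>a \<le> 1\<close>.\<close>
  also have "\<dots> = \<theta> * a - (\<gamma> - 1) * m * (1 - a)" by (simp add: algebra_simps)
  also have "\<dots> \<le> \<theta> * a" using \<gamma> m0 a by simp
  finally show "measure (\<mu> \<bind> \<kappa>) S - \<gamma> * measure (\<nu> \<bind> \<kappa>) S
      \<le> \<theta> * E_div \<gamma> \<mu> \<nu> + max 0 (1 - \<gamma>)"
    using \<gamma> by (simp add: a_def)
qed

section \<open>Laws obtained by binding kernels\<close>

lemma bind_in_prob_algebra:
  assumes "\<mu> \<in> space (prob_algebra M)" "\<kappa> \<in> M \<rightarrow>\<^sub>M prob_algebra N"
  shows "\<mu> \<bind> \<kappa> \<in> space (prob_algebra N)"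
  \<comment> \<open>Measurability of binding in a parameter is specialised to a constant family over
    the dummy space \<open>count_space UNIV\<close> and evaluated at an arbitrary point.\<close>
  using measurable_space[OF measurable_bind_prob_space[OF measurable_const[OF assms(1)] assms(2)],
      of undefined "count_space UNIV"] by simp

text \<open>Tower property: the conditional probability of \<open>Z\<close> lying in
  \<open>S\<close> integrates to the unconditional one, and by hypothesis it is almost surely a
  function of \<open>W\<close> alone, so the integral can be taken over the law of
  \<open>W\<close>.\<close>

lemma distr_eq_bind_of_has_cond_law:
  fixes Z W :: "'w \<Rightarrow> 'a::topological_space"
  assumes "prob_space M" and sub: "subalgebra M F"
    and Z[measurable]: "Z \<in> borel_measurable M" and W[measurable]: "W \<in> borel_measurable M"
    and \<kappa>[measurable]: "\<kappa> \<in> borel \<rightarrow>\<^sub>M prob_algebra borel"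
    and law: "has_cond_law M F Z \<kappa> W"
  shows "distr M borel Z = distr M borel W \<bind> \<kappa>"
proof -
  interpret prob_space M by fact
  interpret finite_measure_subalgebra M F by unfold_locales fact
  have \<kappa>_sub: "\<kappa> \<in> borel \<rightarrow>\<^sub>M subprob_algebra borel"
    using \<kappa> by (rule measurable_prob_algebraD)
  have in_alg: "distr M borel Z \<in> space (prob_algebra borel)" "distr M borel W \<in> space (prob_algebra borel)"
    by (auto simp: space_prob_algebra prob_space_distr)
  have bind: "distr M borel W \<bind> \<kappa> \<in> space (prob_algebra borel)"
    using in_alg(2) \<kappa> by (rule bind_in_prob_algebra)
  interpret W: prob_space "distr M borel W" using in_alg by (simp add: space_prob_algebra)
  interpret Z: prob_space "distr M borel Z" using in_alg by (simp add: space_prob_algebra)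
  interpret bind: prob_space "distr M borel W \<bind> \<kappa>" using bind by (simp add: space_prob_algebra)
  show ?thesis
  proof (rule measure_eqI)
    show "sets (distr M borel Z) = sets (distr M borel W \<bind> \<kappa>)"
      using bind by (simp add: space_prob_algebra)
    fix S assume "S \<in> sets (distr M borel Z)"
    then have S[measurable]: "S \<in> sets borel" by simp
    let ?I = "indicator (Z -` S \<inter> space M) :: 'w \<Rightarrow> real"
    have "measure (distr M borel Z) S = (\<integral>\<omega>. ?I \<omega> \<partial>M)"
      by (simp add: measure_distr emeasure_eq_measure)
    also have "\<dots> = (\<integral>\<omega>. real_cond_exp M F ?I \<omega> \<partial>M)"
      by (intro real_cond_exp_int(2)[symmetric] integrable_real_indicator) (auto simp: emeasure_eq_measure)
    also have "\<dots> = (\<integral>\<omega>. measure (\<kappa> (W \<omega>)) S \<partial>M)"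
      using law S by (intro integral_cong_AE) (auto simp: has_cond_law_def)
    also have "\<dots> = (\<integral>x. measure (\<kappa> x) S \<partial>distr M borel W)"
      by (subst integral_distr) auto
    also have "\<dots> = measure (distr M borel W \<bind> \<kappa>) S"
      using \<kappa>_sub by (subst W.measure_bind[where N=borel]) auto
    finally show "emeasure (distr M borel Z) S = emeasure (distr M borel W \<bind> \<kappa>) S"
      by (simp add: Z.emeasure_eq_measure bind.emeasure_eq_measure)
  qed
qed

section \<open>The Gaussian law: coordinates, projections and measurability\<close>

lemma sets_gaussian [simp, measurable_cong]: "sets (gaussian \<sigma> x) = sets borel"
  by (simp add: gaussian_def)

lemma space_gaussian [simp]: "space (gaussian \<sigma> x) = UNIV"
  by (simp add: gaussian_def)

text \<open>Density and indicator both factor over the coordinates, so the integral over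
  \<open>lborel\<close> splits. Normalisation, marginals and independence are all read off from this
  formula.\<close>

lemma emeasure_gaussian_box:
  fixes x :: "'a::euclidean_space"
  assumes A: "\<And>b. b \<in> Basis \<Longrightarrow> A b \<in> sets borel"
  shows "emeasure (gaussian \<sigma> x) {z. \<forall>b\<in>Basis. z \<bullet> b \<in> A b} =
    (\<Prod>b\<in>Basis. emeasure (density lborel (normal_density (x \<bullet> b) \<sigma>)) (A b))"
proof -
  have [measurable]: "{z::'a. \<forall>b\<in>Basis. z \<bullet> b \<in> A b} \<in> sets borel"
  proof -
    have "(\<lambda>z::'a. z \<bullet> b) -` A b \<inter> space borel \<in> sets borel" if "b \<in> Basis" for b
      using A[OF that] by (intro measurable_sets[of _ borel borel]) auto
    then have "(\<Inter>b\<in>Basis. (\<lambda>z::'a. z \<bullet> b) -` A b \<inter> space borel) \<in> sets borel"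
      by (intro sets.finite_INT) auto
    also have "(\<Inter>b\<in>Basis. (\<lambda>z::'a. z \<bullet> b) -` A b \<inter> space borel) = {z. \<forall>b\<in>Basis. z \<bullet> b \<in> A b}"
      by auto
    finally show ?thesis .
  qed
  have ind: "indicator {z. \<forall>b\<in>Basis. z \<bullet> b \<in> A b} z = (\<Prod>b\<in>Basis. indicator (A b) (z \<bullet> b) :: ennreal)"
    for z :: 'a
  proof (cases "\<forall>b\<in>Basis. z \<bullet> b \<in> A b")
    case False
    then obtain b where "b \<in> Basis" "z \<bullet> b \<notin> A b" by auto
    then have "(\<Prod>b\<in>Basis. indicator (A b) (z \<bullet> b) :: ennreal) = 0"
      by (intro prod_zero bexI[of _ b]) auto
    with False show ?thesis by (simp add: indicator_def)
  qed simp
  have "emeasure (gaussian \<sigma> x) {z. \<forall>b\<in>Basis. z \<bullet> b \<in> A b} =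
    (\<integral>\<^sup>+z. ennreal (\<Prod>b\<in>Basis. normal_density (x \<bullet> b) \<sigma> (z \<bullet> b)) *
      indicator {z. \<forall>b\<in>Basis. z \<bullet> b \<in> A b} z \<partial>lborel)"
    unfolding gaussian_def by (subst emeasure_density) auto
  also have "\<dots> = (\<integral>\<^sup>+z. (\<Prod>b\<in>Basis. ennreal (normal_density (x \<bullet> b) \<sigma> (z \<bullet> b)) *
      indicator (A b) (z \<bullet> b)) \<partial>lborel)"
    by (simp add: ind prod.distrib prod_ennreal normal_density_nonneg)
  also have "\<dots> = (\<Prod>b\<in>Basis. \<integral>\<^sup>+u. ennreal (normal_density (x \<bullet> b) \<sigma> u) * indicator (A b) u \<partial>lborel)"
    using A by (intro nn_integral_lborel_prod) auto
  also have "\<dots> = (\<Prod>b\<in>Basis. emeasure (density lborel (normal_density (x \<bullet> b) \<sigma>)) (A b))"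
    using A by (intro prod.cong refl) (simp add: emeasure_density)
  finally show ?thesis .
qed

lemma prob_space_gaussian:
  fixes x :: "'a::euclidean_space"
  assumes "0 < \<sigma>"
  shows "prob_space (gaussian \<sigma> x)"
proof
  have "emeasure (density lborel (normal_density (x \<bullet> b) \<sigma>)) UNIV = 1" for b
    using prob_space.emeasure_space_1[OF prob_space_normal_density[OF assms, of "x \<bullet> b"]] by simp
  then show "emeasure (gaussian \<sigma> x) (space (gaussian \<sigma> x)) = 1"
    using emeasure_gaussian_box[of "\<lambda>_. UNIV" \<sigma> x] by simp
qed

lemma distributed_gaussian_component:
  fixes x :: "'a::euclidean_space"
  assumes "0 < \<sigma>" and b: "b \<in> Basis"
  shows "distributed (gaussian \<sigma> x) lborel (\<lambda>z. z \<bullet> b) (normal_density (x \<bullet> b) \<sigma>)"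
  unfolding distributed_def
proof (intro conjI)
  let ?D = "\<lambda>b. density lborel (normal_density (x \<bullet> b) \<sigma>)"
  show "distr (gaussian \<sigma> x) lborel (\<lambda>z. z \<bullet> b) = ?D b"
  proof (rule measure_eqI)
    fix S assume "S \<in> sets (distr (gaussian \<sigma> x) lborel (\<lambda>z. z \<bullet> b))"
    then have S[measurable]: "S \<in> sets borel" by simp
    \<comment> \<open>A box constrained in the single direction \<open>b\<close>; every other factor
      is the total mass 1.\<close>
    define A where "A b' = (if b' = b then S else UNIV)" for b'
    have "emeasure (distr (gaussian \<sigma> x) lborel (\<lambda>z. z \<bullet> b)) S = emeasure (gaussian \<sigma> x) {z. z \<bullet> b \<in> S}"
      by (subst emeasure_distr) (auto simp: vimage_def)
    also have "{z. z \<bullet> b \<in> S} = {z. \<forall>b\<in>Basis. z \<bullet> b \<in> A b}"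
      using b by (auto simp: A_def)
    also have "emeasure (gaussian \<sigma> x) \<dots> = (\<Prod>b\<in>Basis. emeasure (?D b) (A b))"
      using S by (intro emeasure_gaussian_box) (simp add: A_def)
    also have "\<dots> = (\<Prod>b'\<in>Basis. if b' = b then emeasure (?D b) S else 1)"
    proof (rule prod.cong)
      fix b' :: 'a
      show "emeasure (?D b') (A b') = (if b' = b then emeasure (?D b) S else 1)"
        using prob_space.emeasure_space_1[OF prob_space_normal_density[OF assms(1), of "x \<bullet> b'"]]
        by (simp add: A_def)
    qed simp
    also have "\<dots> = emeasure (?D b) S" using b by simp
    finally show "emeasure (distr (gaussian \<sigma> x) lborel (\<lambda>z. z \<bullet> b)) S = emeasure (?D b) S" .
  qed simp
qed auto

text \<open>Independence amounts to the joint law of the coordinates being the product of the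
  marginals, and equality with a product measure need only be checked on boxes.\<close>

lemma indep_vars_gaussian:
  fixes x :: "'a::euclidean_space"
  assumes "0 < \<sigma>"
  shows "prob_space.indep_vars (gaussian \<sigma> x) (\<lambda>_. borel) (\<lambda>b z. z \<bullet> b) Basis"
proof -
  interpret prob_space "gaussian \<sigma> x" by (rule prob_space_gaussian) fact
  let ?D = "\<lambda>b. distr (gaussian \<sigma> x) borel (\<lambda>z. z \<bullet> b)"
  have D: "?D b = density lborel (normal_density (x \<bullet> b) \<sigma>)" if "b \<in> Basis" for b
    using distributed_distr_eq_density[OF distributed_gaussian_component[OF assms that, of x]]
    by (simp cong: distr_cong)
  interpret P: product_sigma_finite ?D
    unfolding product_sigma_finite_def
    by (auto intro!: prob_space_imp_sigma_finite prob_space_distr)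
  have "distr (gaussian \<sigma> x) (\<Pi>\<^sub>M b\<in>Basis. borel) (\<lambda>z. \<lambda>b\<in>Basis. z \<bullet> b) = (\<Pi>\<^sub>M b\<in>Basis. ?D b)"
  proof (rule P.PiM_eqI)
    show "sets (distr (gaussian \<sigma> x) (\<Pi>\<^sub>M b\<in>Basis. borel) (\<lambda>z. \<lambda>b\<in>Basis. z \<bullet> b)) = sets (\<Pi>\<^sub>M b\<in>Basis. ?D b)"
      by (simp cong: sets_PiM_cong)
  next
    fix A :: "'a \<Rightarrow> real set" assume A: "\<And>b. b \<in> Basis \<Longrightarrow> A b \<in> sets (?D b)"
    have "emeasure (distr (gaussian \<sigma> x) (\<Pi>\<^sub>M b\<in>Basis. borel) (\<lambda>z. \<lambda>b\<in>Basis. z \<bullet> b)) (Pi\<^sub>E Basis A) =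
        emeasure (gaussian \<sigma> x) {z. \<forall>b\<in>Basis. z \<bullet> b \<in> A b}"
      using A by (subst emeasure_distr) (auto intro!: sets_PiM_I_finite measurable_restrict arg_cong2[where f=emeasure])
    also have "\<dots> = (\<Prod>b\<in>Basis. emeasure (?D b) (A b))"
      using A by (subst emeasure_gaussian_box) (auto intro!: prod.cong simp: D)
    finally show "emeasure (distr (gaussian \<sigma> x) (\<Pi>\<^sub>M b\<in>Basis. borel) (\<lambda>z. \<lambda>b\<in>Basis. z \<bullet> b)) (Pi\<^sub>E Basis A) =
        (\<Prod>b\<in>Basis. emeasure (?D b) (A b))" .
  qed simp
  then show ?thesis
    by (subst indep_vars_iff_distr_eq_PiM') auto
qed

text \<open>\<open>v \<bullet> z\<close> is a sum of independent normal variables, so means and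
  variances add.\<close>

lemma distributed_gaussian_inner:
  fixes x v :: "'a::euclidean_space"
  assumes \<sigma>: "0 < \<sigma>" and v: "v \<noteq> 0"
  shows "distributed (gaussian \<sigma> x) lborel (\<lambda>z. v \<bullet> z) (normal_density (v \<bullet> x) (\<sigma> * norm v))"
proof -
  interpret prob_space "gaussian \<sigma> x" by (rule prob_space_gaussian) fact
  \<comment> \<open>Directions with \<open>v \<bullet> b = 0\<close> would contribute degenerate
    summands of deviation 0, while \<open>sum_indep_normal\<close> needs positive deviations and a
    nonempty index set; the latter holds as \<open>v \<noteq> 0\<close>.\<close>
  define I where "I = {b\<in>Basis. v \<bullet> b \<noteq> 0}"
  have I: "finite I" "I \<subseteq> Basis" by (auto simp: I_def)
  have "I \<noteq> {}"
    using v euclidean_all_zero_iff[of v] by (auto simp: I_def)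
  have sum_I: "(\<Sum>b\<in>I. (v \<bullet> b) * (z \<bullet> b)) = v \<bullet> z" for z
    unfolding euclidean_inner[of v z] by (rule sum.mono_neutral_left) (auto simp: I_def)
  have indep: "indep_vars (\<lambda>_. borel) (\<lambda>b z. (v \<bullet> b) * (z \<bullet> b)) I"
    using indep_vars_compose2[OF indep_vars_subset[OF indep_vars_gaussian[OF \<sigma>] I(2)],
        of "\<lambda>b u. (v \<bullet> b) * u" "\<lambda>_. borel"] by simp
  have dist: "distributed (gaussian \<sigma> x) lborel (\<lambda>z. (v \<bullet> b) * (z \<bullet> b))
      (normal_density ((v \<bullet> b) * (x \<bullet> b)) (\<bar>v \<bullet> b\<bar> * \<sigma>))" if "b \<in> I" for b
    using normal_density_affine[OF distributed_gaussian_component[OF \<sigma>, of b x] \<sigma>, of "v \<bullet> b" 0] that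
    by (simp add: I_def)
  have "distributed (gaussian \<sigma> x) lborel (\<lambda>z. \<Sum>b\<in>I. (v \<bullet> b) * (z \<bullet> b))
      (normal_density (\<Sum>b\<in>I. (v \<bullet> b) * (x \<bullet> b)) (sqrt (\<Sum>b\<in>I. (\<bar>v \<bullet> b\<bar> * \<sigma>)\<^sup>2)))"
    using I \<open>I \<noteq> {}\<close> indep dist \<sigma> by (intro sum_indep_normal) (auto simp: I_def)
  moreover have "sqrt (\<Sum>b\<in>I. (\<bar>v \<bullet> b\<bar> * \<sigma>)\<^sup>2) = \<sigma> * norm v"
  proof -
    have "(\<Sum>b\<in>I. (\<bar>v \<bullet> b\<bar> * \<sigma>)\<^sup>2) = \<sigma>\<^sup>2 * (\<Sum>b\<in>I. (v \<bullet> b) * (v \<bullet> b))"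
      unfolding sum_distrib_left
      by (intro sum.cong) (simp_all add: power_mult_distrib power2_eq_square)
    then have "(\<Sum>b\<in>I. (\<bar>v \<bullet> b\<bar> * \<sigma>)\<^sup>2) = \<sigma>\<^sup>2 * (v \<bullet> v)"
      unfolding sum_I .
    then show ?thesis using \<sigma> by (simp add: norm_eq_sqrt_inner real_sqrt_mult)
  qed
  ultimately show ?thesis by (simp add: sum_I)
qed

lemma measurable_gaussian:
  assumes "0 < \<sigma>"
  shows "gaussian \<sigma> \<in> borel \<rightarrow>\<^sub>M prob_algebra (borel :: 'a::euclidean_space measure)"
proof (rule measurable_prob_algebraI)
  show "prob_space (gaussian \<sigma> x)" for x :: 'a
    using assms by (rule prob_space_gaussian)
  show "gaussian \<sigma> \<in> borel \<rightarrow>\<^sub>M subprob_algebra (borel :: 'a measure)"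
  proof (rule measurable_subprob_algebra)
    show "subprob_space (gaussian \<sigma> x)" for x :: 'a
      using assms by (intro prob_space_imp_subprob_space prob_space_gaussian)
    fix S :: "'a set" assume [measurable]: "S \<in> sets borel"
    have "(\<lambda>x::'a. \<integral>\<^sup>+y. ennreal (\<Prod>b\<in>Basis. normal_density (x \<bullet> b) \<sigma> (y \<bullet> b)) * indicator S y \<partial>lborel)
        \<in> borel_measurable borel"
      unfolding normal_density_def by measurable
    then show "(\<lambda>x. emeasure (gaussian \<sigma> x) S) \<in> borel_measurable borel"
      by (simp add: gaussian_def emeasure_density)
  qed simp
qed

section \<open>Normal tails and half-spaces\<close>

lemma Q_fun_eq_measure: "Q_fun a = measure (density lborel std_normal_density) {a..}"
proof -
  have "measure (density lborel std_normal_density) {a..} = (\<integral>u. indicator {a..} u \<partial>density lborel std_normal_density)"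
    by simp
  also have "\<dots> = (\<integral>u. std_normal_density u * indicator {a..} u \<partial>lborel)"
    by (subst integral_density) auto
  also have "\<dots> = (\<integral>u. (1 / sqrt (2 * pi)) * (indicator {a..} u *\<^sub>R exp (- u\<^sup>2 / 2)) \<partial>lborel)"
    by (intro Bochner_Integration.integral_cong) (auto simp: std_normal_density_def)
  finally show ?thesis
    by (simp add: Q_fun_def set_lebesgue_integral_def)
qed

lemma antimono_Q_fun: "antimono Q_fun"
proof
  fix a b :: real assume "a \<le> b"
  interpret prob_space "density lborel std_normal_density"
    by (rule prob_space_normal_density) simp
  show "Q_fun b \<le> Q_fun a"
    unfolding Q_fun_eq_measure using \<open>a \<le> b\<close> by (intro finite_measure_mono) auto
qed

text \<open>A half-space only sees the projection onto its normal vector, which has mean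
  \<open>v \<bullet> x\<close> and deviation \<open>\<sigma> * norm v\<close>; standardising it
  leaves a tail of the standard normal law.\<close>

lemma measure_gaussian_halfspace:
  fixes x v :: "'a::euclidean_space"
  assumes \<sigma>: "0 < \<sigma>" and v: "v \<noteq> 0"
  shows "measure (gaussian \<sigma> x) {z. c \<le> v \<bullet> z} = Q_fun ((c - v \<bullet> x) / (\<sigma> * norm v))"
proof -
  interpret prob_space "gaussian \<sigma> x" by (rule prob_space_gaussian) fact
  define s where "s = \<sigma> * norm v"
  have s: "0 < s" using assms by (simp add: s_def)
  have "distributed (gaussian \<sigma> x) lborel (\<lambda>z. (v \<bullet> z - v \<bullet> x) / s) std_normal_density"
    using distributed_gaussian_inner[OF assms, of x] normal_standard_normal_convert[OF s, of "\<lambda>z. v \<bullet> z" "v \<bullet> x"]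
    by (simp add: s_def)
  then have "density lborel std_normal_density = distr (gaussian \<sigma> x) lborel (\<lambda>z. (v \<bullet> z - v \<bullet> x) / s)"
    by (simp add: distributed_def)
  then have "Q_fun ((c - v \<bullet> x) / s) =
      measure (gaussian \<sigma> x) ((\<lambda>z. (v \<bullet> z - v \<bullet> x) / s) -` {(c - v \<bullet> x) / s..} \<inter> UNIV)"
    unfolding Q_fun_eq_measure by (simp add: measure_distr)
  also have "(\<lambda>z. (v \<bullet> z - v \<bullet> x) / s) -` {(c - v \<bullet> x) / s..} \<inter> UNIV = {z. c \<le> v \<bullet> z}"
    using s by (auto simp: divide_le_cancel)
  finally show ?thesis by (simp add: s_def)
qed

section \<open>Optimality of half-spaces and the behaviour of \<open>\<theta>_fun\<close>\<close>

lemma integrable_gaussian_density: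
  fixes x :: "'a::euclidean_space"
  assumes "0 < \<sigma>"
  shows "integrable lborel (\<lambda>z. \<Prod>b\<in>Basis. normal_density (x \<bullet> b) \<sigma> (z \<bullet> b))"
proof (rule integrableI_nonneg)
  interpret prob_space "gaussian \<sigma> x" by (rule prob_space_gaussian) fact
  show "(\<integral>\<^sup>+z. ennreal (\<Prod>b\<in>Basis. normal_density (x \<bullet> b) \<sigma> (z \<bullet> b)) \<partial>lborel) < \<infinity>"
    using emeasure_space_1 by (simp add: gaussian_def emeasure_density)
qed (auto intro!: prod_nonneg simp: normal_density_nonneg)

lemma measure_gaussian_eq_integral:
  fixes x :: "'a::euclidean_space"
  assumes [measurable]: "S \<in> sets borel"
  shows "measure (gaussian \<sigma> x) S =
    (\<integral>z. (\<Prod>b\<in>Basis. normal_density (x \<bullet> b) \<sigma> (z \<bullet> b)) * indicator S z \<partial>lborel)"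
proof -
  have "measure (gaussian \<sigma> x) S = (\<integral>z. indicator S z \<partial>gaussian \<sigma> x)" by simp
  also have "\<dots> = (\<integral>z. (\<Prod>b\<in>Basis. normal_density (x \<bullet> b) \<sigma> (z \<bullet> b)) * indicator S z \<partial>lborel)"
    unfolding gaussian_def by (subst integral_density) (auto intro!: prod_nonneg simp: normal_density_nonneg)
  finally show ?thesis .
qed

text \<open>Puts the density in a form whose leading factor does not depend on the mean, so that a
  likelihood comparison reduces to comparing distances.\<close>

lemma gaussian_density_eq:
  fixes x z :: "'a::euclidean_space"
  shows "(\<Prod>b\<in>Basis. normal_density (x \<bullet> b) \<sigma> (z \<bullet> b)) =
    (1 / sqrt (2 * pi * \<sigma>\<^sup>2)) ^ DIM('a) * exp (- (norm (z - x))\<^sup>2 / (2 * \<sigma>\<^sup>2))"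
proof -
  have "(norm (z - x))\<^sup>2 = (\<Sum>b\<in>Basis. (z \<bullet> b - x \<bullet> b)\<^sup>2)"
    unfolding power2_norm_eq_inner euclidean_inner[of "z - x" "z - x"]
    by (simp add: inner_diff_left power2_eq_square)
  then have "exp (- (norm (z - x))\<^sup>2 / (2 * \<sigma>\<^sup>2)) = (\<Prod>b\<in>Basis. exp (- (z \<bullet> b - x \<bullet> b)\<^sup>2 / (2 * \<sigma>\<^sup>2)))"
    by (simp add: exp_sum[symmetric] sum_divide_distrib[symmetric] sum_negf)
  then show ?thesis
    by (simp only: normal_density_def prod.distrib prod_constant)
qed

text \<open>Neyman-Pearson: the left side is the integral over \<open>S\<close> of
  \<open>p x - \<gamma> * p y\<close>, which is largest when \<open>S\<close> is the set where this
  integrand is nonnegative. For two normal laws with equal covariance that set is a half-space,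
  whose value is exactly \<open>\<theta>_fun\<close>.\<close>

lemma gaussian_diff_le_theta_norm:
  fixes x y :: "'a::euclidean_space"
  assumes \<sigma>: "0 < \<sigma>" and \<gamma>: "0 < \<gamma>" and "x \<noteq> y" and S[measurable]: "S \<in> sets borel"
  shows "measure (gaussian \<sigma> x) S - \<gamma> * measure (gaussian \<sigma> y) S \<le> \<theta>_fun \<gamma> (norm (x - y) / \<sigma>)"
proof -
  define v where "v = x - y"
  define r where "r = norm v / \<sigma>"
  \<comment> \<open>The threshold comes from solving \<open>\<gamma> * p y z \<le> p x z\<close>:
    after taking logarithms the quadratic terms in \<open>z\<close> cancel, leaving a linear
    condition on \<open>v \<bullet> z\<close>.\<close>
  define c where "c = \<sigma>\<^sup>2 * ln \<gamma> + ((norm x)\<^sup>2 - (norm y)\<^sup>2) / 2"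
  define p where "p x z = (\<Prod>b\<in>Basis. normal_density (x \<bullet> b) \<sigma> (z \<bullet> b))" for x z :: 'a
  define H where "H = {z. c \<le> v \<bullet> z}"
  have v: "v \<noteq> 0" using \<open>x \<noteq> y\<close> by (simp add: v_def)
  have r: "0 < r" "norm v = r * \<sigma>" using v \<sigma> by (simp_all add: r_def)
  have H[measurable]: "H \<in> sets borel" unfolding H_def by measurable
  have int_p: "integrable lborel (\<lambda>z. p w z * indicator T z)" if "T \<in> sets borel" for w and T :: "'a set"
    unfolding p_def using that integrable_gaussian_density[OF \<sigma>]
    by (intro integrable_real_mult_indicator) auto
  have p_iff: "\<gamma> * p y z \<le> p x z \<longleftrightarrow> z \<in> H" for z
  proof -
    define k where "k = (1 / sqrt (2 * pi * \<sigma>\<^sup>2)) ^ DIM('a)"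
    have k: "0 < k" using \<sigma> by (simp add: k_def)
    have "\<gamma> * p y z = k * exp (ln \<gamma> - (norm (z - y))\<^sup>2 / (2 * \<sigma>\<^sup>2))"
      using \<gamma> by (simp add: p_def gaussian_density_eq k_def diff_conv_add_uminus exp_add del: add_uminus_conv_diff)
    moreover have "p x z = k * exp (- (norm (z - x))\<^sup>2 / (2 * \<sigma>\<^sup>2))"
      by (simp add: p_def gaussian_density_eq k_def)
    ultimately have "\<gamma> * p y z \<le> p x z \<longleftrightarrow>
        exp (ln \<gamma> - (norm (z - y))\<^sup>2 / (2 * \<sigma>\<^sup>2)) \<le> exp (- (norm (z - x))\<^sup>2 / (2 * \<sigma>\<^sup>2))"
      using k by simp
    also have "\<dots> \<longleftrightarrow> 2 * \<sigma>\<^sup>2 * ln \<gamma> \<le> (norm (z - y))\<^sup>2 - (norm (z - x))\<^sup>2"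
    proof -
      have "l - a / q \<le> - b / q \<longleftrightarrow> q * l \<le> a - b" if "0 < q" for l a b q :: real
      proof -
        have "l - a / q \<le> - b / q \<longleftrightarrow> l \<le> (a - b) / q"
          unfolding diff_divide_distrib by auto
        then show ?thesis using that by (simp add: pos_le_divide_eq mult.commute)
      qed
      from this[of "2 * \<sigma>\<^sup>2"] show ?thesis using \<sigma> by simp
    qed
    also have "\<dots> \<longleftrightarrow> z \<in> H"
      by (simp add: H_def c_def v_def power2_norm_eq_inner inner_diff_left inner_diff_right
          inner_commute field_simps)
    finally show ?thesis .
  qed
  have "measure (gaussian \<sigma> x) S - \<gamma> * measure (gaussian \<sigma> y) S =
      (\<integral>z. p x z * indicator S z - \<gamma> * (p y z * indicator S z) \<partial>lborel)"
    using int_p[OF S] by (simp add: measure_gaussian_eq_integral p_def)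
  also have "\<dots> \<le> (\<integral>z. p x z * indicator H z - \<gamma> * (p y z * indicator H z) \<partial>lborel)"
  proof (rule integral_mono)
    \<comment> \<open>Pointwise, replacing \<open>S\<close> by \<open>H\<close> only adds
      nonnegative values of the integrand and drops negative ones.\<close>
    show "p x z * indicator S z - \<gamma> * (p y z * indicator S z) \<le>
        p x z * indicator H z - \<gamma> * (p y z * indicator H z)" for z
      using p_iff[of z] by (cases "z \<in> S"; cases "z \<in> H") auto
  qed (intro Bochner_Integration.integrable_diff integrable_mult_right int_p S H)+
  also have "\<dots> = measure (gaussian \<sigma> x) H - \<gamma> * measure (gaussian \<sigma> y) H"
    using int_p[OF H] by (simp add: measure_gaussian_eq_integral p_def)
  also have "\<dots> = \<theta>_fun \<gamma> r"
  proof -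
    have vv: "(r * \<sigma>)\<^sup>2 = x \<bullet> x - 2 * (x \<bullet> y) + y \<bullet> y"
      unfolding r(2)[symmetric] by (simp add: v_def power2_norm_eq_inner inner_diff_left inner_diff_right inner_commute)
    \<comment> \<open>The projected means lie symmetrically about
      \<open>c - \<sigma>\<^sup>2 * ln \<gamma>\<close>. Dividing by
      \<open>\<sigma> * norm v = r * \<sigma>\<^sup>2\<close> yields the two arguments of
      \<open>Q_fun\<close> in \<open>\<theta>_fun\<close>.\<close>
    have "c - v \<bullet> x = \<sigma>\<^sup>2 * ln \<gamma> - (r * \<sigma>)\<^sup>2 / 2" "c - v \<bullet> y = \<sigma>\<^sup>2 * ln \<gamma> + (r * \<sigma>)\<^sup>2 / 2"
      unfolding vv by (simp_all add: c_def v_def power2_norm_eq_inner inner_diff_left inner_diff_right inner_commute field_simps)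
    moreover have "(\<sigma>\<^sup>2 * ln \<gamma> - (r * \<sigma>)\<^sup>2 / 2) / (\<sigma> * norm v) = ln \<gamma> / r - r / 2"
      "(\<sigma>\<^sup>2 * ln \<gamma> + (r * \<sigma>)\<^sup>2 / 2) / (\<sigma> * norm v) = ln \<gamma> / r + r / 2"
      using r \<sigma> by (simp_all add: field_simps power2_eq_square)
    ultimately have "(c - v \<bullet> x) / (\<sigma> * norm v) = ln \<gamma> / r - r / 2"
      "(c - v \<bullet> y) / (\<sigma> * norm v) = ln \<gamma> / r + r / 2"
      by (simp_all only:)
    then show ?thesis
      unfolding H_def measure_gaussian_halfspace[OF \<sigma> v] by (simp add: \<theta>_fun_def)
  qed
  finally show ?thesis by (simp add: r_def v_def)
qed

text \<open>Monotonicity of \<open>\<theta>\<close> in \<open>r\<close>, and its sign, come for free from the optimality of half-spaces applied on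
  the real line: \<open>Q a - \<gamma> Q (a + r)\<close> is a value of the functional that \<open>\<theta>\<close> maximises.\<close>

lemma Q_fun_diff_le_theta:
  assumes "0 < \<gamma>" "0 < r"
  shows "Q_fun a - \<gamma> * Q_fun (a + r) \<le> \<theta>_fun \<gamma> r"
  \<comment> \<open>Unit-variance laws centred at 0 and \<open>- r\<close> give the half-line
    \<open>{a..}\<close> the masses \<open>Q_fun a\<close> and \<open>Q_fun (a + r)\<close>.\<close>
  using gaussian_diff_le_theta_norm[of 1 \<gamma> 0 "- r" "{a..}"] assms
    measure_gaussian_halfspace[where \<sigma>=1 and v="1::real" and c=a and x=0]
    measure_gaussian_halfspace[where \<sigma>=1 and v="1::real" and c=a and x="- r"]
  by (simp add: atLeast_def)

lemma theta_nonneg: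
  assumes "0 < \<gamma>" "0 < r"
  shows "0 \<le> \<theta>_fun \<gamma> r"
  using gaussian_diff_le_theta_norm[of 1 \<gamma> r "0::real" "{}"] assms by simp

lemma theta_mono:
  assumes "0 < \<gamma>" "0 < r" "r \<le> s"
  shows "\<theta>_fun \<gamma> r \<le> \<theta>_fun \<gamma> s"
proof -
  define a where "a = ln \<gamma> / r - r / 2"
  have "\<theta>_fun \<gamma> r = Q_fun a - \<gamma> * Q_fun (a + r)"
    by (simp add: \<theta>_fun_def a_def add.commute)
  \<comment> \<open>The threshold \<open>a\<close>, optimal for \<open>r\<close>, is kept fixed
    while the separation grows to \<open>s\<close>; only the subtracted tail changes, and it
    shrinks.\<close>
  also have "\<dots> \<le> Q_fun a - \<gamma> * Q_fun (a + s)"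
    using antimonoD[OF antimono_Q_fun, of "a + r" "a + s"] assms by simp
  also have "\<dots> \<le> \<theta>_fun \<gamma> s"
    using assms by (intro Q_fun_diff_le_theta) auto
  finally show ?thesis .
qed

text \<open>Monotonicity replaces the distance by an upper bound \<open>\<rho>\<close>. Coinciding
  means define no half-space and are handled apart: there \<open>\<gamma> \<ge> 1\<close> makes the
  left side nonpositive.\<close>

lemma gaussian_diff_le_theta:
  fixes x y :: "'a::euclidean_space"
  assumes \<sigma>: "0 < \<sigma>" and \<gamma>: "1 \<le> \<gamma>" and S: "S \<in> sets borel"
    and \<rho>: "0 < \<rho>" "norm (x - y) \<le> \<rho>"
  shows "measure (gaussian \<sigma> x) S - \<gamma> * measure (gaussian \<sigma> y) S \<le> \<theta>_fun \<gamma> (\<rho> / \<sigma>)"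
proof (cases "x = y")
  case True
  have "measure (gaussian \<sigma> y) S \<le> \<gamma> * measure (gaussian \<sigma> y) S"
    using mult_right_mono[OF \<gamma> measure_nonneg[of "gaussian \<sigma> y" S]] by simp
  with True theta_nonneg[of \<gamma> "\<rho> / \<sigma>"] assms show ?thesis by simp
next
  case False
  have "measure (gaussian \<sigma> x) S - \<gamma> * measure (gaussian \<sigma> y) S \<le> \<theta>_fun \<gamma> (norm (x - y) / \<sigma>)"
    using assms False by (intro gaussian_diff_le_theta_norm) auto
  also have "\<dots> \<le> \<theta>_fun \<gamma> (\<rho> / \<sigma>)"
    using assms False by (intro theta_mono divide_right_mono) auto
  finally show ?thesis .
qed

section \<open>Propagation along the Markov chain\<close>

text \<open>Reduces the chain of random variables to a recursion on marginal laws, by integrating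
  the conditional laws of \<open>Y t\<close> and of \<open>X (t + 1)\<close> in turn. This lets two
  chains on different probability spaces be compared.\<close>

lemma markov_chain_laws:
  fixes X Y :: "nat \<Rightarrow> 'w \<Rightarrow> 'a::topological_space"
  assumes chain: "markov_chain n G K M X Y" and t: "t \<in> {1..n}"
    and G: "G t \<in> borel \<rightarrow>\<^sub>M prob_algebra borel" and K: "K t \<in> borel \<rightarrow>\<^sub>M prob_algebra borel"
  shows "distr M borel (X (t + 1)) = distr M borel (X t) \<bind> G t \<bind> K t"
proof -
  have X: "X s \<in> borel_measurable M" if "s \<in> {1..n+1}" for s
    using chain that by (auto simp: markov_chain_def)
  have Y: "Y s \<in> borel_measurable M" if "s \<in> {1..n}" for s
    using chain that by (auto simp: markov_chain_def)
  let ?F = "generated_algebra M (X ` {1..t} \<union> Y ` {1..<t})"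
  let ?F' = "generated_algebra M (X ` {1..t} \<union> Y ` {1..t})"
  have sub: "subalgebra M ?F" "subalgebra M ?F'"
    using X Y t by (auto intro!: subalgebra_generated_algebra)
  have laws: "prob_space M" "has_cond_law M ?F (Y t) (G t) (X t)"
    "has_cond_law M ?F' (X (t + 1)) (K t) (Y t)"
    using chain t by (auto simp: markov_chain_def)
  have "distr M borel (Y t) = distr M borel (X t) \<bind> G t"
    using laws sub X Y t G by (intro distr_eq_bind_of_has_cond_law) auto
  moreover have "distr M borel (X (t + 1)) = distr M borel (Y t) \<bind> K t"
    using laws sub X Y t K by (intro distr_eq_bind_of_has_cond_law) auto
  ultimately show ?thesis by simp
qed

lemma measure_bind_eq_1:
  assumes \<mu>: "\<mu> \<in> space (prob_algebra M)" and \<kappa>: "\<kappa> \<in> M \<rightarrow>\<^sub>M prob_algebra N"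
    and B: "B \<in> sets N" "\<And>x. measure (\<kappa> x) B = 1"
  shows "measure (\<mu> \<bind> \<kappa>) B = 1"
proof -
  have "prob_space \<mu>" and s: "sets \<mu> = sets M" using \<mu> by (auto simp: space_prob_algebra)
  interpret prob_space \<mu> by fact
  have "measure (\<mu> \<bind> \<kappa>) B = (\<integral>x. measure (\<kappa> x) B \<partial>\<mu>)"
    using measurable_prob_algebraD[OF \<kappa>] B measurable_cong_sets[OF s refl]
    by (intro measure_bind) auto
  then show ?thesis by (simp add: B prob_space)
qed

text \<open>One step of the chain: \<open>\<kappa>\<close> does not increase the divergence, and the
  Gaussian kernel contracts it because points of \<open>B\<close> are at most \<open>2 * R\<close>
  apart.\<close>

lemma E_div_gaussian_bind_le:
  fixes \<mu> \<nu> :: "'a::euclidean_space measure" and \<kappa> :: "'a \<Rightarrow> 'b::topological_space measure"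
  assumes \<mu>: "\<mu> \<in> space (prob_algebra borel)" "measure \<mu> B = 1"
    and \<nu>: "\<nu> \<in> space (prob_algebra borel)" "measure \<nu> B = 1"
    and B: "B \<in> sets borel" and R: "0 < R" "\<And>x. x \<in> B \<Longrightarrow> norm x \<le> R"
    and \<sigma>: "0 < \<sigma>" and \<kappa>: "\<kappa> \<in> borel \<rightarrow>\<^sub>M prob_algebra borel" and \<gamma>: "1 \<le> \<gamma>"
  shows "E_div \<gamma> (\<mu> \<bind> gaussian \<sigma> \<bind> \<kappa>) (\<nu> \<bind> gaussian \<sigma> \<bind> \<kappa>)
    \<le> \<theta>_fun \<gamma> (2 * R / \<sigma>) * E_div \<gamma> \<mu> \<nu>"
proof -
  have in_alg: "\<mu> \<bind> gaussian \<sigma> \<in> space (prob_algebra borel)" "\<nu> \<bind> gaussian \<sigma> \<in> space (prob_algebra borel)"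
    using \<mu> \<nu> measurable_gaussian[OF \<sigma>] by (auto intro: bind_in_prob_algebra)
  have one: "measure \<eta> UNIV = 1" if "\<eta> \<in> space (prob_algebra borel)" for \<eta> :: "'a measure"
    using that prob_space.prob_space[of \<eta>] sets_eq_imp_space_eq[of \<eta> borel]
    by (auto simp: space_prob_algebra)
  have "E_div \<gamma> (\<mu> \<bind> gaussian \<sigma> \<bind> \<kappa>) (\<nu> \<bind> gaussian \<sigma> \<bind> \<kappa>)
      \<le> 1 * E_div \<gamma> (\<mu> \<bind> gaussian \<sigma>) (\<nu> \<bind> gaussian \<sigma>)"
  \<comment> \<open>Data processing: the contraction lemma with factor 1 and the whole space in
    place of \<open>B\<close>, since Gaussian outputs are not confined to \<open>B\<close>.\<close>
  proof (rule E_div_bind_le[OF in_alg \<kappa> \<gamma>])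
    fix x y :: 'a and S :: "'b set"
    have "prob_space (\<kappa> x)" using measurable_space[OF \<kappa>, of x] by (simp add: space_prob_algebra)
    moreover have "0 \<le> \<gamma> * measure (\<kappa> y) S" using \<gamma> by simp
    ultimately show "measure (\<kappa> x) S - \<gamma> * measure (\<kappa> y) S \<le> 1"
      using prob_space.prob_le_1[of "\<kappa> x" S] by linarith
  qed (use in_alg one in auto)
  also have "\<dots> \<le> \<theta>_fun \<gamma> (2 * R / \<sigma>) * E_div \<gamma> \<mu> \<nu>"
    unfolding mult_1
  proof (rule E_div_bind_le[OF \<mu>(1) \<nu>(1) measurable_gaussian[OF \<sigma>] \<gamma> B \<mu>(2) \<nu>(2)])
    fix x y S assume "x \<in> B" "y \<in> B" "S \<in> sets (borel :: 'a measure)"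
    moreover from this have "norm (x - y) \<le> 2 * R"
      using norm_triangle_ineq4[of x y] R(2)[of x] R(2)[of y] by simp
    ultimately show "measure (gaussian \<sigma> x) S - \<gamma> * measure (gaussian \<sigma> y) S \<le> \<theta>_fun \<gamma> (2 * R / \<sigma>)"
      using \<sigma> \<gamma> R by (intro gaussian_diff_le_theta) auto
  qed
  finally show ?thesis .
qed

lemma E_div_chain_ge_1:
  fixes \<mu> \<nu> :: "nat \<Rightarrow> 'a::euclidean_space measure"
  assumes init: "\<mu> 1 \<in> space (prob_algebra borel)" "measure (\<mu> 1) B = 1"
      "\<nu> 1 \<in> space (prob_algebra borel)" "measure (\<nu> 1) B = 1"
    and step: "\<And>t. t \<in> {1..n} \<Longrightarrow> \<mu> (t + 1) = \<mu> t \<bind> gaussian (\<sigma> t) \<bind> K t"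
      "\<And>t. t \<in> {1..n} \<Longrightarrow> \<nu> (t + 1) = \<nu> t \<bind> gaussian (\<sigma> t) \<bind> K t"
    and B: "B \<in> sets borel" and R: "0 < R" "\<And>x. x \<in> B \<Longrightarrow> norm x \<le> R"
    and \<sigma>: "\<And>t. t \<in> {1..n} \<Longrightarrow> 0 < \<sigma> t"
    and K: "\<And>t. t \<in> {1..n} \<Longrightarrow> K t \<in> borel \<rightarrow>\<^sub>M prob_algebra borel"
    and K_B: "\<And>t y. t \<in> {1..n} \<Longrightarrow> measure (K t y) B = 1"
    and \<gamma>: "1 \<le> \<gamma>"
  shows "E_div \<gamma> (\<mu> (n + 1)) (\<nu> (n + 1)) \<le> E_div \<gamma> (\<mu> 1) (\<nu> 1) * (\<Prod>t=1..n. \<theta>_fun \<gamma> (2 * R / \<sigma> t))"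
proof -
  \<comment> \<open>Concentration on \<open>B\<close> is carried through the induction because the
    Gaussian contraction needs it at every time.\<close>
  have *: "\<mu> (m + 1) \<in> space (prob_algebra borel) \<and> measure (\<mu> (m + 1)) B = 1 \<and>
      \<nu> (m + 1) \<in> space (prob_algebra borel) \<and> measure (\<nu> (m + 1)) B = 1 \<and>
      E_div \<gamma> (\<mu> (m + 1)) (\<nu> (m + 1)) \<le> E_div \<gamma> (\<mu> 1) (\<nu> 1) * (\<Prod>t=1..m. \<theta>_fun \<gamma> (2 * R / \<sigma> t))"
    if "m \<le> n" for m
    using that
  proof (induction m)
    case 0
    then show ?case using init by simp
  next
    case (Suc m)
    let ?t = "m + 1"
    have t: "?t \<in> {1..n}" using Suc.prems by simp
    note IH = Suc.IH[OF Suc_leD[OF Suc.prems]]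
    note \<sigma>t = \<sigma>[OF t] and Kt = K[OF t]
    have m: "\<mu> ?t \<bind> gaussian (\<sigma> ?t) \<in> space (prob_algebra borel)"
      "\<nu> ?t \<bind> gaussian (\<sigma> ?t) \<in> space (prob_algebra borel)"
      using IH measurable_gaussian[OF \<sigma>t] by (auto intro: bind_in_prob_algebra)
    have "E_div \<gamma> (\<mu> (?t + 1)) (\<nu> (?t + 1)) \<le> \<theta>_fun \<gamma> (2 * R / \<sigma> ?t) * E_div \<gamma> (\<mu> ?t) (\<nu> ?t)"
      unfolding step[OF t] using IH by (intro E_div_gaussian_bind_le[OF _ _ _ _ B R \<sigma>t Kt \<gamma>]) auto
    also have "\<dots> \<le> \<theta>_fun \<gamma> (2 * R / \<sigma> ?t) *
        (E_div \<gamma> (\<mu> 1) (\<nu> 1) * (\<Prod>t=1..m. \<theta>_fun \<gamma> (2 * R / \<sigma> t)))"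
      \<comment> \<open>Multiplying the induction hypothesis by the new factor preserves the
        inequality since \<open>\<theta>_fun\<close> is nonnegative.\<close>
      using IH \<gamma> R \<sigma>t by (intro mult_left_mono theta_nonneg) auto
    finally have "E_div \<gamma> (\<mu> (?t + 1)) (\<nu> (?t + 1)) \<le>
        E_div \<gamma> (\<mu> 1) (\<nu> 1) * (\<Prod>t=1..?t. \<theta>_fun \<gamma> (2 * R / \<sigma> t))"
      by (simp add: mult_ac)
    moreover have "\<mu> (?t + 1) \<in> space (prob_algebra borel)" "\<nu> (?t + 1) \<in> space (prob_algebra borel)"
      "measure (\<mu> (?t + 1)) B = 1" "measure (\<nu> (?t + 1)) B = 1"
      unfolding step[OF t] using m Kt B K_B[OF t]
      by (auto intro: bind_in_prob_algebra measure_bind_eq_1)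
    ultimately show ?case by simp
  qed
  then show ?thesis by simp
qed

theorem theorem1:
  fixes n :: nat and A \<gamma> :: real and \<sigma> :: "nat \<Rightarrow> real"
    and B :: "(real ^ 'd) set"
    and K :: "nat \<Rightarrow> real ^ 'd \<Rightarrow> (real ^ 'd) measure"
    and \<mu> \<mu>' :: "(real ^ 'd) measure"
    and M :: "'w measure" and X Y :: "nat \<Rightarrow> 'w \<Rightarrow> real ^ 'd"
    and M' :: "'v measure" and X' Y' :: "nat \<Rightarrow> 'v \<Rightarrow> real ^ 'd"
  assumes n: "n \<ge> 1"
    and A: "A > 0"
    and \<sigma>: "\<And>t. t \<in> {1..n} \<Longrightarrow> \<sigma> t > 0"
    and B: "B = {x. (norm x)\<^sup>2 \<le> real CARD('d) * A}"
    and K_kernel: "\<And>t. t \<in> {1..n} \<Longrightarrow> K t \<in> borel \<rightarrow>\<^sub>M prob_algebra borel"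
    and K_into_B: "\<And>t y. t \<in> {1..n} \<Longrightarrow> measure (K t y) B = 1"
    and \<mu>: "\<mu> \<in> space (prob_algebra borel)" "measure \<mu> B = 1"
    and \<mu>': "\<mu>' \<in> space (prob_algebra borel)" "measure \<mu>' B = 1"
    and chain: "markov_chain n (\<lambda>t. gaussian (\<sigma> t)) K M X Y" "distr M borel (X 1) = \<mu>"
    and chain': "markov_chain n (\<lambda>t. gaussian (\<sigma> t)) K M' X' Y'" "distr M' borel (X' 1) = \<mu>'"
    and \<gamma>: "\<gamma> > 0"
  shows "E_div \<gamma> (distr M borel (X (n + 1))) (distr M' borel (X' (n + 1)))
    \<le> E_div \<gamma> \<mu> \<mu>' *
      (\<Prod>t=1..n. \<theta>_fun (max \<gamma> (1 / \<gamma>)) (2 * sqrt (real CARD('d) * A) / \<sigma> t))"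
proof -
  \<comment> \<open>The radius of \<open>B\<close>, so that \<open>2 * R\<close> is the numerator of
    the argument of \<open>\<theta>_fun\<close>.\<close>
  define R where "R = sqrt (real CARD('d) * A)"
  define P where "P t = distr M borel (X t)" for t
  define P' where "P' t = distr M' borel (X' t)" for t
  have R: "0 < R" using A by (simp add: R_def)
  have B_R: "norm x \<le> R" if "x \<in> B" for x
    using that unfolding B R_def by (auto intro: real_le_rsqrt)
  have B_sets: "B \<in> sets borel" unfolding B by measurable
  have P1: "P 1 = \<mu>" "P' 1 = \<mu>'" using chain(2) chain'(2) by (simp_all add: P_def P'_def)
  have P_step: "P (t + 1) = P t \<bind> gaussian (\<sigma> t) \<bind> K t"
    "P' (t + 1) = P' t \<bind> gaussian (\<sigma> t) \<bind> K t" if t: "t \<in> {1..n}" for t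
    unfolding P_def P'_def
    using markov_chain_laws[OF chain(1) t] markov_chain_laws[OF chain'(1) t]
      measurable_gaussian[OF \<sigma>[OF t]] K_kernel[OF t] by auto
  show ?thesis
  proof (cases "1 \<le> \<gamma>")
    case True
    then have "1 / \<gamma> \<le> 1" by simp
    with True have "max \<gamma> (1 / \<gamma>) = \<gamma>" by linarith
    then show ?thesis
      using E_div_chain_ge_1[of P B P' n \<sigma> K R \<gamma>] \<mu> \<mu>' P1 P_step B_sets R B_R \<sigma> K_kernel K_into_B True
      unfolding P_def[symmetric] P'_def[symmetric] R_def[symmetric] by simp
  next
    case False
    then have "1 \<le> 1 / \<gamma>" using \<gamma> by simp
    with False have \<gamma>': "1 \<le> 1 / \<gamma>" "max \<gamma> (1 / \<gamma>) = 1 / \<gamma>" by linarith+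
    have prob: "prob_space \<mu>" "prob_space \<mu>'" "sets \<mu> = sets \<mu>'"
      using \<mu> \<mu>' by (auto simp: space_prob_algebra)
    have "prob_space (P (n + 1))" "prob_space (P' (n + 1))"
      using chain(1) chain'(1) unfolding P_def P'_def markov_chain_def
      by (auto intro!: prob_space.prob_space_distr)
    \<comment> \<open>For \<open>\<gamma> < 1\<close>, exchange the output laws, apply the bound at
      \<open>1 / \<gamma>\<close> to the chains in reverse roles, and exchange the initial laws
      back; this absorbs the prefactor \<open>\<gamma>\<close>.\<close>
    then have "E_div \<gamma> (P (n + 1)) (P' (n + 1)) = \<gamma> * E_div (1 / \<gamma>) (P' (n + 1)) (P (n + 1))"
      using \<gamma> by (intro E_div_swap) (auto simp: P_def P'_def)
    also have "\<dots> \<le> \<gamma> * (E_div (1 / \<gamma>) \<mu>' \<mu> * (\<Prod>t=1..n. \<theta>_fun (1 / \<gamma>) (2 * R / \<sigma> t)))"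
      using E_div_chain_ge_1[of P' B P n \<sigma> K R "1 / \<gamma>"]
        \<mu> \<mu>' P1 P_step B_sets R B_R \<sigma> K_kernel K_into_B \<gamma>' \<gamma>
      by (intro mult_left_mono) auto
    also have "\<dots> = E_div \<gamma> \<mu> \<mu>' * (\<Prod>t=1..n. \<theta>_fun (1 / \<gamma>) (2 * R / \<sigma> t))"
      using E_div_swap[OF prob \<gamma>] by simp
    finally show ?thesis by (simp add: P_def P'_def R_def \<gamma>'(2))
  qed
qed

end
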